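(* Let $K\in(0,1]$ and let $H:[0,\infty)\to[\mu,\nu]\subset(0,1)$ be a Hölder continuous function with exponent $\beta>0$ such that $\sup_{t\ge 0}H(t)<\beta$. Then there exists $\delta>0$ and, for every integer $m\ge 1$, there exists $M_m>0$ such that $$\mathbb{E}\Big|B^{H(t),K}_t-B^{H(s),K}_s\Big|^m\ge M_m\,|t-s|^{m(H(t)\wedge H(s))K}$$ for all $s,t\ge 0$ such that $|t-s|<\delta$, where $a\wedge b=\min(a,b)$.
   Context: $B^{H(\cdot),K}=(B^{H(t),K}_t)_{t\ge 0}$ denotes the centred Gaussian process, starting from zero, with covariance function $$R^{H(\cdot),K}(t,s)=\big(D(H(t),H(s))\big)^{K}\Big[\big(t^{H(t)+H(s)}+s^{H(t)+H(s)}\big)^{K}-|t-s|^{(H(t)+H(s))K}\Big],\qquad s,t\ge 0,$$ where for $x,y\in(0,1)$ $$D(x,y):=\frac{\sqrt{\Gamma(2x+1)\Gamma(2y+1)\sin(\pi x)\sin(\pi y)}}{2\,\Gamma(x+y+1)\sin\big(\frac{\pi(x+y)}{2}\big)}$$ and $\Gamma$ is the Gamma function. *)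

theory Defs
  imports "HOL-Probability.Probability"
begin

definition holder_on :: "real set \<Rightarrow> real \<Rightarrow> (real \<Rightarrow> real) \<Rightarrow> bool" where
  "holder_on S \<beta> f \<longleftrightarrow>
     (\<exists>C\<ge>0. \<forall>s\<in>S. \<forall>t\<in>S. \<bar>f t - f s\<bar> \<le> C * \<bar>t - s\<bar> powr \<beta>)"

(* The degenerate law (variance zero) counts as Gaussian; it occurs at time 0
   and for trivial linear combinations. *)
definition gaussian_rv :: "'a measure \<Rightarrow> ('a \<Rightarrow> real) \<Rightarrow> bool" where
  "gaussian_rv M X \<longleftrightarrow>
     X \<in> borel_measurable M \<and>
     ((\<exists>\<mu>. AE \<omega> in M. X \<omega> = \<mu>) \<or>
      (\<exists>\<mu> \<sigma>. 0 < \<sigma> \<and> distributed M lborel X (normal_density \<mu> \<sigma>)))"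

definition gaussian_process :: "'a measure \<Rightarrow> 'i set \<Rightarrow> ('i \<Rightarrow> 'a \<Rightarrow> real) \<Rightarrow> bool" where
  "gaussian_process M T X \<longleftrightarrow>
     prob_space M \<and>
     (\<forall>J c. finite J \<longrightarrow> J \<subseteq> T \<longrightarrow> gaussian_rv M (\<lambda>\<omega>. \<Sum>t\<in>J. c t * X t \<omega>))"

definition covariance :: "'a measure \<Rightarrow> ('a \<Rightarrow> real) \<Rightarrow> ('a \<Rightarrow> real) \<Rightarrow> real" where
  "covariance M X Y =
     (\<integral>\<omega>. (X \<omega> - (\<integral>\<omega>'. X \<omega>' \<partial>M)) * (Y \<omega> - (\<integral>\<omega>'. Y \<omega>' \<partial>M)) \<partial>M)"

definition mbm_D :: "real \<Rightarrow> real \<Rightarrow> real" where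
  "mbm_D x y =
     sqrt (Gamma (2 * x + 1) * Gamma (2 * y + 1) * sin (pi * x) * sin (pi * y)) /
     (2 * Gamma (x + y + 1) * sin (pi * (x + y) / 2))"

definition mbbm_cov :: "(real \<Rightarrow> real) \<Rightarrow> real \<Rightarrow> real \<Rightarrow> real \<Rightarrow> real" where
  "mbbm_cov H K t s =
     mbm_D (H t) (H s) powr K *
     ((t powr (H t + H s) + s powr (H t + H s)) powr K - \<bar>t - s\<bar> powr ((H t + H s) * K))"

(* The multifractional bifractional Brownian motion with Hurst function H and
   parameter K, indexed by t \<ge> 0. *)
definition mbbm :: "'a measure \<Rightarrow> (real \<Rightarrow> real) \<Rightarrow> real \<Rightarrow> (real \<Rightarrow> 'a \<Rightarrow> real) \<Rightarrow> bool" where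
  "mbbm M H K B \<longleftrightarrow>
     gaussian_process M {0..} B \<and>
     (AE \<omega> in M. B 0 \<omega> = 0) \<and>
     (\<forall>t\<ge>0. (\<integral>\<omega>. B t \<omega> \<partial>M) = 0) \<and>
     (\<forall>s\<ge>0. \<forall>t\<ge>0. covariance M (B t) (B s) = mbbm_cov H K t s)"

end

theory Submission
  imports Defs
begin

text \<open>
  The increment \<open>B t - B s\<close> is a centred Gaussian variable, so its \<open>m\<close>-th absolute moment is a
  constant times the \<open>m\<close>-th power of its standard deviation, and it suffices to bound its
  variance \<open>V\<close> from below by a multiple of \<open>h powr (2 * min a b * K)\<close>, where \<open>s < t\<close>,
  \<open>h = t - s\<close>, \<open>a = H t\<close> and \<open>b = H s\<close>.  Put \<open>q = a + b\<close>, \<open>p = q * K\<close> and \<open>x = (a - b) * K\<close>.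
  Expanding the covariances gives

  \<open>V = t powr (p + x) + s powr (p - x) - 2 * D powr K * (t powr q + s powr q) powr K
        + 2 * D powr K * h powr p\<close>

  with \<open>D = mbm_D a b\<close>.  Three estimates control this expression.

  \<^item> \<open>D \<le> 1 / 2\<close> (\<open>mbm_D_le_half\<close>), because \<open>ln (Gamma (2 * x + 1) * sin (pi * x))\<close> is
    concave; and \<open>D\<close> is close to \<open>1 / 2\<close> when \<open>h\<close> is small, by uniform continuity.

  \<^item> At a constant exponent, concavity of \<open>u powr K\<close> makes
    \<open>t powr p + s powr p - 2 * ((t powr q + s powr q) / 2) powr K\<close> nonpositive, but it is at
    least \<open>- (h powr p)\<close> (\<open>bifractional_gap\<close>), and it vanishes for \<open>K = 1\<close>.  The positive term
    \<open>2 * D powr K * h powr p\<close> has a coefficient close to \<open>2 powr (1 - K)\<close>, which exceeds the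
    possible loss for every \<open>K\<close>, so a positive multiple of \<open>h powr p\<close> survives.

  \<^item> Moving the two exponents from \<open>p\<close> to \<open>p + x\<close> and \<open>p - x\<close> costs only a small multiple of
    \<open>h powr p\<close> (\<open>exponent_perturbation\<close>).  For bounded \<open>s\<close> the cost is of first order:
    \<open>\<bar>x\<bar>\<close> is \<open>O(h powr \<beta>)\<close>, and it multiplies an increment of \<open>u powr p * ln u\<close>.  For large
    \<open>s\<close> that increment need not stay bounded, but there the second-order term of the
    exponential compensates: completing the square leaves a loss of order \<open>h\<^sup>2\<close>.

  Finally \<open>h powr p\<close> is comparable to \<open>h powr (2 * min a b * K)\<close>, since their exponents differ
  by \<open>\<bar>x\<bar>\<close>, which is \<open>O(h powr \<beta>)\<close>, and \<open>h powr \<beta> * ln h\<close> is bounded.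
\<close>

section \<open>Absolute moments of Gaussian increments\<close>

lemma normal_abs_moment_scaling:
  "\<exists>c>0. \<forall>\<sigma>>0. (\<integral>x. normal_density 0 \<sigma> x * \<bar>x\<bar> ^ m \<partial>lborel) = c * \<sigma> ^ m"
proof (cases "even m")
  case True
  then obtain k where m: "m = 2 * k" by (auto elim: evenE)
  have "(\<integral>x. normal_density 0 \<sigma> x * \<bar>x\<bar> ^ m \<partial>lborel) = fact (2 * k) / (2 ^ k * fact k) * \<sigma> ^ m"
    if "0 < \<sigma>" for \<sigma> :: real
    using integral_normal_moment_even[OF that, of 0 k]
    by (simp add: m power_even_abs power_divide power_mult divide_simps)
  then show ?thesis by (intro exI[of _ "fact (2 * k) / (2 ^ k * fact k)"]) auto
next
  case False
  then obtain k where m: "m = 2 * k + 1" by (auto elim: oddE)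
  have "(\<integral>x. normal_density 0 \<sigma> x * \<bar>x\<bar> ^ m \<partial>lborel) = 2 ^ k * fact k * sqrt (2 / pi) * \<sigma> ^ m"
    if "0 < \<sigma>" for \<sigma> :: real
    using integral_normal_moment_abs_odd[OF that, of 0 k] by (simp add: m mult_ac)
  then show ?thesis by (intro exI[of _ "2 ^ k * fact k * sqrt (2 / pi)"]) auto
qed

lemma gaussian_rv_integrable_power:
  assumes "prob_space M" "gaussian_rv M X"
  shows "integrable M (\<lambda>\<omega>. X \<omega> ^ k)"
proof -
  interpret prob_space M by fact
  have X[measurable]: "X \<in> borel_measurable M" using assms(2) by (simp add: gaussian_rv_def)
  from assms(2) consider (const) \<mu> where "AE \<omega> in M. X \<omega> = \<mu>"
    | (normal) \<mu> \<sigma> where "0 < \<sigma>" "distributed M lborel X (normal_density \<mu> \<sigma>)"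
    unfolding gaussian_rv_def by blast
  then show ?thesis
  proof cases
    case const
    then have "integrable M (\<lambda>\<omega>. X \<omega> ^ k) \<longleftrightarrow> integrable M (\<lambda>\<omega>. \<mu> ^ k)"
      by (intro integrable_cong_AE) auto
    then show ?thesis by simp
  next
    case normal
    have "integrable lborel
        (\<lambda>x. \<Sum>j\<le>k. (of_nat (k choose j) * \<mu> ^ (k - j)) * (normal_density \<mu> \<sigma> x * (x - \<mu>) ^ j))"
      by (intro Bochner_Integration.integrable_sum integrable_mult_right
            integrable_normal_moment[OF normal(1)])
    also have "(\<lambda>x. \<Sum>j\<le>k. (of_nat (k choose j) * \<mu> ^ (k - j)) * (normal_density \<mu> \<sigma> x * (x - \<mu>) ^ j))
        = (\<lambda>x. normal_density \<mu> \<sigma> x * ((x - \<mu>) + \<mu>) ^ k)"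
      unfolding binomial_ring sum_distrib_left by (simp add: mult_ac)
    finally have "integrable lborel (\<lambda>x. normal_density \<mu> \<sigma> x * x ^ k)" by simp
    then show ?thesis
      using distributed_integrable[OF normal(2), of "\<lambda>x. x ^ k"] by simp
  qed
qed

text \<open>
  The standard deviation determines the law of a centred Gaussian variable, and moments scale
  with it; the constant depends on the power only.  A degenerate centred variable is almost surely
  zero, and both sides vanish.
\<close>

lemma gaussian_rv_abs_moment:
  assumes "prob_space M" "0 < m"
  shows "\<exists>c>0. \<forall>X. gaussian_rv M X \<longrightarrow> (\<integral>\<omega>. X \<omega> \<partial>M) = 0 \<longrightarrow>
           (\<integral>\<omega>. \<bar>X \<omega>\<bar> ^ m \<partial>M) = c * sqrt (\<integral>\<omega>. (X \<omega>)\<^sup>2 \<partial>M) ^ m"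
proof -
  interpret prob_space M by fact
  obtain c where c: "c > 0" and
    scale: "\<And>\<sigma>. 0 < \<sigma> \<Longrightarrow> (\<integral>x. normal_density 0 \<sigma> x * \<bar>x\<bar> ^ m \<partial>lborel) = c * \<sigma> ^ m"
    using normal_abs_moment_scaling[of m] by blast
  have "(\<integral>\<omega>. \<bar>X \<omega>\<bar> ^ m \<partial>M) = c * sqrt (\<integral>\<omega>. (X \<omega>)\<^sup>2 \<partial>M) ^ m"
    if X: "gaussian_rv M X" and mean: "(\<integral>\<omega>. X \<omega> \<partial>M) = 0" for X
  proof -
    have [measurable]: "X \<in> borel_measurable M" using X by (simp add: gaussian_rv_def)
    from X consider (const) \<mu> where "AE \<omega> in M. X \<omega> = \<mu>"
      | (normal) \<mu> \<sigma> where "0 < \<sigma>" "distributed M lborel X (normal_density \<mu> \<sigma>)"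
      unfolding gaussian_rv_def by blast
    then show ?thesis
    proof cases
      case const
      then have "expectation X = expectation (\<lambda>_. \<mu>)" by (intro integral_cong_AE) auto
      with mean have \<mu>: "\<mu> = 0" by (simp add: prob_space)
      have "(\<integral>\<omega>. \<bar>X \<omega>\<bar> ^ m \<partial>M) = (\<integral>\<omega>. 0 \<partial>M)" "(\<integral>\<omega>. (X \<omega>)\<^sup>2 \<partial>M) = (\<integral>\<omega>. 0 \<partial>M)"
        using const \<mu> assms(2) by (intro integral_cong_AE; force)+
      then show ?thesis using assms(2) by simp
    next
      case normal
      have \<mu>: "\<mu> = 0" using normal_distributed_expectation[OF normal] mean by simp
      have "(\<integral>\<omega>. (X \<omega>)\<^sup>2 \<partial>M) = \<sigma>\<^sup>2"
        using normal_distributed_variance[OF normal] mean by simp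
      moreover have "(\<integral>\<omega>. \<bar>X \<omega>\<bar> ^ m \<partial>M) = c * \<sigma> ^ m"
        using distributed_integral[OF normal(2), of "\<lambda>x. \<bar>x\<bar> ^ m"] scale[OF normal(1)] \<mu> by simp
      ultimately show ?thesis using normal(1) by simp
    qed
  qed
  with c show ?thesis by blast
qed

lemma gaussian_process_marginal:
  assumes "gaussian_process M T X" "t \<in> T"
  shows "gaussian_rv M (X t)"
  using assms(1)[unfolded gaussian_process_def, THEN conjunct2, rule_format, of "{t}" "\<lambda>_. 1"] assms(2)
  by simp

lemma gaussian_process_increment:
  assumes "gaussian_process M T X" "s \<in> T" "t \<in> T" "s \<noteq> t"
  shows "gaussian_rv M (\<lambda>\<omega>. X t \<omega> - X s \<omega>)"
  using assms(1)[unfolded gaussian_process_def, THEN conjunct2, rule_format,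
      of "{s, t}" "\<lambda>u. if u = t then 1 else -1"] assms(2-4)
  by simp

text \<open>
  Polarisation turns the prescribed covariances into the variance of an increment; the Gaussian
  marginals provide the integrability that makes the prescribed integrals meaningful.
\<close>

lemma mbbm_increment:
  assumes B: "mbbm M H K B" and "0 \<le> s" "0 \<le> t" "s \<noteq> t"
  shows "gaussian_rv M (\<lambda>\<omega>. B t \<omega> - B s \<omega>)"
    and "(\<integral>\<omega>. B t \<omega> - B s \<omega> \<partial>M) = 0"
    and "(\<integral>\<omega>. (B t \<omega> - B s \<omega>)\<^sup>2 \<partial>M) = mbbm_cov H K t t + mbbm_cov H K s s - 2 * mbbm_cov H K t s"
proof -
  have gp: "gaussian_process M {0..} B" and mean: "\<And>u. 0 \<le> u \<Longrightarrow> (\<integral>\<omega>. B u \<omega> \<partial>M) = 0"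
    and cov: "\<And>u v. 0 \<le> u \<Longrightarrow> 0 \<le> v \<Longrightarrow> covariance M (B u) (B v) = mbbm_cov H K u v"
    using B unfolding mbbm_def by blast+
  have ps: "prob_space M" using gp by (simp add: gaussian_process_def)
  have int: "integrable M (\<lambda>\<omega>. B u \<omega> ^ k)" if "0 \<le> u" for u k
    using gaussian_rv_integrable_power[OF ps gaussian_process_marginal[OF gp]] that by simp
  show G: "gaussian_rv M (\<lambda>\<omega>. B t \<omega> - B s \<omega>)"
    using gaussian_process_increment[OF gp] assms by simp
  show "(\<integral>\<omega>. B t \<omega> - B s \<omega> \<partial>M) = 0"
    using int[of t 1] int[of s 1] mean assms by simp
  have moment: "(\<integral>\<omega>. B u \<omega> * B v \<omega> \<partial>M) = mbbm_cov H K u v" if "0 \<le> u" "0 \<le> v" for u v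
    using cov[OF that] mean that by (simp add: covariance_def)
  have 1: "B t \<omega> * B s \<omega> = ((B t \<omega>)\<^sup>2 + (B s \<omega>)\<^sup>2 - (B t \<omega> - B s \<omega>)\<^sup>2) / 2" for \<omega>
    by (simp add: power2_eq_square algebra_simps)
  have "(\<integral>\<omega>. B t \<omega> * B s \<omega> \<partial>M)
      = ((\<integral>\<omega>. (B t \<omega>)\<^sup>2 \<partial>M) + (\<integral>\<omega>. (B s \<omega>)\<^sup>2 \<partial>M) - (\<integral>\<omega>. (B t \<omega> - B s \<omega>)\<^sup>2 \<partial>M)) / 2"
    unfolding 1 using int[of t 2] int[of s 2] gaussian_rv_integrable_power[OF ps G, of 2] assms by simp
  then show "(\<integral>\<omega>. (B t \<omega> - B s \<omega>)\<^sup>2 \<partial>M)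
      = mbbm_cov H K t t + mbbm_cov H K s s - 2 * mbbm_cov H K t s"
    using moment[of t s] moment[of t t] moment[of s s] assms by (simp add: power2_eq_square)
qed

section \<open>The normalising factor\<close>

lemma trigamma_le:
  fixes x :: real
  assumes "1 < x"
  shows "Polygamma 1 x \<le> pi\<^sup>2 / 6"
proof -
  have "(\<lambda>n. 1 / (real n + 1)\<^sup>2) sums (pi\<^sup>2 / 6)"
    using inverse_squares_sums by (simp add: add_ac)
  moreover have "Polygamma 1 (1::real) = (\<Sum>k. 1 / (real k + 1)\<^sup>2)"
    by (simp add: Polygamma_def divide_inverse add_ac numeral_2_eq_2)
  ultimately have "Polygamma 1 (1::real) = pi\<^sup>2 / 6" by (simp add: sums_unique[symmetric])
  with Polygamma_real_strict_antimono[of 1 x 1] assms show ?thesis by simp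
qed

text \<open>
  The second derivative is \<open>4 * Polygamma 1 (2 * x + 1) - pi\<^sup>2 / (sin (pi * x))\<^sup>2\<close>.  The trigamma
  function decreases from its value \<open>pi\<^sup>2 / 6\<close> at \<open>1\<close>, so the first summand is at most
  \<open>2 / 3 * pi\<^sup>2\<close>, while the subtracted one is at least \<open>pi\<^sup>2\<close>.
\<close>

lemma concave_ln_Gamma_sin:
  "concave_on {0<..<1} (\<lambda>x::real. ln_Gamma (2 * x + 1) + ln (sin (pi * x)))"
proof (rule f''_le0_imp_concave)
  fix x :: real assume x: "x \<in> {0<..<1}"
  then have s: "0 < sin (pi * x)" by (intro sin_gt_zero) auto
  show "((\<lambda>x. ln_Gamma (2 * x + 1) + ln (sin (pi * x))) has_real_derivative
          (2 * Digamma (2 * x + 1) + pi * (cos (pi * x) / sin (pi * x)))) (at x)"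
    using x s by (auto intro!: derivative_eq_intros simp: field_simps)
  have nz: "2 * x + 1 \<notin> \<int>\<^sub>\<le>\<^sub>0" using x by (auto elim!: nonpos_Ints_cases)
  show "((\<lambda>x. 2 * Digamma (2 * x + 1) + pi * (cos (pi * x) / sin (pi * x))) has_real_derivative
          (4 * Polygamma 1 (2 * x + 1) - pi\<^sup>2 / (sin (pi * x))\<^sup>2)) (at x)"
  proof -
    have "((\<lambda>x. Digamma (2 * x + 1)) has_real_derivative (Polygamma (Suc 0) (2 * x + 1) * 2)) (at x)"
      by (rule DERIV_chain2[where f = Digamma and g = "\<lambda>x. 2 * x + 1",
            OF has_field_derivative_Polygamma[OF nz]])
         (auto intro!: derivative_eq_intros)
    moreover have "((\<lambda>x. cos (pi * x) / sin (pi * x)) has_real_derivative 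
        (- pi / (sin (pi * x))\<^sup>2)) (at x)"
    proof -
      have "((\<lambda>x. cos (pi * x) / sin (pi * x)) has_real_derivative
          ((- sin (pi * x) * pi) * sin (pi * x) - cos (pi * x) * (cos (pi * x) * pi))
            / (sin (pi * x) * sin (pi * x))) (at x)"
        using s by (auto intro!: derivative_eq_intros)
      also have "(- sin (pi * x) * pi) * sin (pi * x) - cos (pi * x) * (cos (pi * x) * pi)
          = - pi * ((sin (pi * x))\<^sup>2 + (cos (pi * x))\<^sup>2)"
        by (simp only: power2_eq_square algebra_simps mult_minus_left mult_minus_right minus_add_distrib)
      also have "\<dots> = - pi" by (simp only: sin_cos_squared_add mult_1_right)
      finally show ?thesis by (simp add: power2_eq_square)
    qed
    ultimately have "((\<lambda>x. 2 * Digamma (2 * x + 1) + pi * (cos (pi * x) / sin (pi * x)))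
        has_real_derivative
          (2 * (Polygamma (Suc 0) (2 * x + 1) * 2) + pi * (- pi / (sin (pi * x))\<^sup>2))) (at x)"
      by (intro DERIV_add DERIV_cmult)
    then show ?thesis by (simp add: power2_eq_square mult_ac)
  qed
  show "4 * Polygamma 1 (2 * x + 1) - pi\<^sup>2 / (sin (pi * x))\<^sup>2 \<le> 0"
  proof -
    have "pi\<^sup>2 \<le> pi\<^sup>2 / (sin (pi * x))\<^sup>2"
      using s by (simp add: field_simps power_le_one)
    moreover have "Polygamma 1 (2 * x + 1) \<le> pi\<^sup>2 / 6"
      using x by (intro trigamma_le) auto
    ultimately show ?thesis using zero_le_power2[of pi] by linarith
  qed
qed auto

lemma mbm_D_denominator_pos:
  assumes "0 < x" "x < 1" "0 < y" "y < 1"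
  shows "0 < Gamma (x + y + 1) * sin (pi * (x + y) / 2)"
proof -
  have "0 < sin (pi * ((x + y) / 2))" using assms by (intro sin_gt_zero) auto
  then show ?thesis using assms by (auto intro!: mult_pos_pos)
qed

text \<open>
  With \<open>F z = Gamma (2 * z + 1) * sin (pi * z)\<close>, the quotient is
  \<open>sqrt (F x * F y) / (2 * F ((x + y) / 2))\<close>, so the bound is midpoint concavity of \<open>ln F\<close>.
\<close>

lemma mbm_D_le_half:
  assumes "0 < x" "x < 1" "0 < y" "y < 1"
  shows "mbm_D x y \<le> 1 / 2"
proof -
  define F where "F z = Gamma (2 * z + 1) * sin (pi * z)" for z :: real
  have F_pos: "0 < F z" if "0 < z" "z < 1" for z
    unfolding F_def using that by (intro mult_pos_pos sin_gt_zero) auto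
  have ln_F: "ln (F z) = ln_Gamma (2 * z + 1) + ln (sin (pi * z))" if "0 < z" "z < 1" for z
    unfolding F_def using that
    by (subst ln_mult_pos) (auto simp: ln_Gamma_real_pos intro!: sin_gt_zero)
  define z where "z = (x + y) / 2"
  have z: "0 < z" "z < 1" using assms by (auto simp: z_def)
  have "(ln (F x) + ln (F y)) / 2 \<le> ln (F z)"
    using concave_onD[OF concave_ln_Gamma_sin, of "1/2" x y] assms z
    by (simp add: ln_F) (simp add: z_def add_divide_distrib)
  then have "ln (F x * F y) \<le> ln ((F z)\<^sup>2)"
    using F_pos[of x] F_pos[of y] F_pos[of z] assms z by (simp add: ln_mult_pos ln_realpow)
  then have "F x * F y \<le> (F z)\<^sup>2"
    using F_pos[of x] F_pos[of y] F_pos[of z] assms z by (subst (asm) ln_le_cancel_iff) auto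
  then have "sqrt (F x * F y) \<le> F z"
    using F_pos[of z] z by (intro real_le_lsqrt) auto
  moreover have "mbm_D x y = sqrt (F x * F y) / (2 * F z)"
  proof -
    have 1: "F z = Gamma (x + y + 1) * sin (pi * (x + y) / 2)"
    proof -
      have "2 * z = x + y" "pi * z = pi * (x + y) / 2" by (simp_all add: z_def)
      then show ?thesis by (simp only: F_def)
    qed
    have 2: "F x * F y = Gamma (2 * x + 1) * Gamma (2 * y + 1) * sin (pi * x) * sin (pi * y)"
      by (simp add: F_def mult_ac)
    show ?thesis by (simp only: mbm_D_def 1 2 mult.assoc)
  qed
  ultimately show ?thesis using F_pos[of z] z by (simp add: pos_divide_le_eq)
qed

lemma mbm_D_diag:
  assumes "0 < x" "x < 1"
  shows "mbm_D x x = 1 / 2"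
proof -
  have s: "0 < sin (pi * x)" and G: "0 < Gamma (2 * x + 1)"
    using assms by (auto intro!: sin_gt_zero)
  have "sqrt (Gamma (2 * x + 1) * Gamma (2 * x + 1) * sin (pi * x) * sin (pi * x))
      = sqrt ((Gamma (2 * x + 1) * sin (pi * x))\<^sup>2)"
    by (simp add: power2_eq_square mult_ac)
  also have "\<dots> = Gamma (2 * x + 1) * sin (pi * x)" using s G by (simp add: less_imp_le)
  finally show ?thesis using s G by (simp add: mbm_D_def)
qed

lemma mbm_D_nonneg:
  assumes "0 < x" "x < 1" "0 < y" "y < 1"
  shows "0 \<le> mbm_D x y"
proof -
  have "0 \<le> sin (pi * x)" "0 \<le> sin (pi * y)"
    using assms by (auto intro!: sin_ge_zero)
  moreover have "0 < Gamma (2 * x + 1)" "0 < Gamma (2 * y + 1)" using assms by auto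
  ultimately show ?thesis unfolding mbm_D_def
    using mbm_D_denominator_pos[OF assms] by (intro divide_nonneg_nonneg) (auto simp: mult.assoc)
qed

lemma continuous_on_mbm_D:
  assumes "0 < \<mu>" "\<nu> < 1"
  shows "continuous_on ({\<mu>..\<nu>} \<times> {\<mu>..\<nu>}) (\<lambda>z. mbm_D (fst z) (snd z))"
proof -
  have "continuous_on {0<..} (Gamma :: real \<Rightarrow> real)"
    by (intro continuous_on_Gamma) (auto elim!: nonpos_Ints_cases)
  then have cG: "continuous_on A (\<lambda>z. Gamma (f z))"
    if "continuous_on A f" "\<And>z. z \<in> A \<Longrightarrow> 0 < f z" for A and f :: "real \<times> real \<Rightarrow> real"
    by (rule continuous_on_compose2) (use that in auto)
  have "2 * Gamma (x + y + 1) * sin (pi * (x + y) / 2) \<noteq> 0"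
    if "x \<in> {\<mu>..\<nu>}" "y \<in> {\<mu>..\<nu>}" for x y
    using mbm_D_denominator_pos[of x y] that assms by auto
  then show ?thesis unfolding mbm_D_def
    by (intro continuous_on_divide continuous_on_real_sqrt continuous_on_mult continuous_on_sin
          continuous_on_add continuous_on_fst continuous_on_snd continuous_on_id
          continuous_on_const cG continuous_intros)
       (use assms in auto)
qed

lemma mbm_D_powr_near_diag:
  assumes "0 < \<mu>" "\<nu> < 1" "0 < K" "0 < e"
  shows "\<exists>\<eta>>0. \<forall>x\<in>{\<mu>..\<nu>}. \<forall>y\<in>{\<mu>..\<nu>}. \<bar>x - y\<bar> < \<eta> \<longrightarrow> (1 / 2) powr K - e \<le> mbm_D x y powr K"
proof -
  have "uniformly_continuous_on ({\<mu>..\<nu>} \<times> {\<mu>..\<nu>}) (\<lambda>z. mbm_D (fst z) (snd z) powr K)"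
    using assms mbm_D_nonneg
    by (intro compact_uniformly_continuous compact_Times compact_Icc continuous_on_powr'
          continuous_on_mbm_D continuous_on_const) auto
  then obtain \<eta> where \<eta>: "\<eta> > 0" and uc: "\<And>z w. z \<in> {\<mu>..\<nu>} \<times> {\<mu>..\<nu>} \<Longrightarrow> w \<in> {\<mu>..\<nu>} \<times> {\<mu>..\<nu>} \<Longrightarrow>
      dist w z < \<eta> \<Longrightarrow> dist (mbm_D (fst w) (snd w) powr K) (mbm_D (fst z) (snd z) powr K) < e"
    unfolding uniformly_continuous_on_def using assms(4) by metis
  have "(1 / 2) powr K - e \<le> mbm_D x y powr K"
    if "x \<in> {\<mu>..\<nu>}" "y \<in> {\<mu>..\<nu>}" "\<bar>x - y\<bar> < \<eta>" for x y
  proof -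
    have "dist (mbm_D x y powr K) (mbm_D x x powr K) < e"
      using uc[of "(x, x)" "(x, y)"] that by (simp add: dist_Pair_Pair dist_real_def abs_minus_commute)
    then show ?thesis using that assms by (simp add: mbm_D_diag dist_real_def)
  qed
  with \<eta> show ?thesis by blast
qed

section \<open>Increments at a constant exponent\<close>

lemma powr_add_le_sum:
  fixes x y r :: real
  assumes "0 \<le> x" "0 \<le> y" "0 \<le> r" "r \<le> 1"
  shows "(x + y) powr r \<le> x powr r + y powr r"
proof (cases "x + y = 0")
  case False
  with assms have pos: "0 < x + y" by simp
  have le: "u * (x + y) powr r \<le> (u * (x + y)) powr r" if "0 \<le> u" "u \<le> 1" for u
    using powr_mono'[of r 1 u] that assms pos
    by (simp add: powr_mult mult_right_mono)
  have "(x + y) powr r = x / (x + y) * (x + y) powr r + y / (x + y) * (x + y) powr r"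
    using pos by (simp add: add_divide_distrib[symmetric] distrib_right[symmetric])
  also have "\<dots> \<le> x powr r + y powr r"
    using le[of "x / (x + y)"] le[of "y / (x + y)"] assms pos by simp
  finally show ?thesis .
qed (use assms in auto)

lemma powr_midpoint_le:
  fixes x y r :: real
  assumes "0 \<le> x" "0 \<le> y" "1 \<le> r"
  shows "((x + y) / 2) powr r \<le> (x powr r + y powr r) / 2"
proof -
  have half: "(z / 2) powr r \<le> z powr r / 2" if "0 \<le> z" for z :: real
  proof -
    have "(1 / 2) powr r \<le> (1 / 2) powr (1::real)"
      using assms by (intro powr_mono') auto
    then have "(1 / 2) powr r * z powr r \<le> (1 / 2) * z powr r"
      by (intro mult_right_mono) auto
    then show ?thesis using powr_mult[of "1/2" z r] that by simp
  qed
  show ?thesis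
  proof (cases "x = 0 \<or> y = 0")
    case True
    then show ?thesis using half[of x] half[of y] assms by auto
  next
    case False
    with assms have "x > 0" "y > 0" by auto
    with convex_onD[OF powr_convex[OF assms(3)], of "1/2" x y]
    show ?thesis by (simp add: field_simps)
  qed
qed

text \<open>
  A lower bound for the defect of concavity of \<open>u powr K\<close>.  If \<open>q * K \<le> 1\<close>, both \<open>t powr (q * K)\<close>
  and, by subadditivity, \<open>s powr (q * K) + (t - s) powr (q * K)\<close> dominate the power of the mean.
  Otherwise, since \<open>q \<le> 2\<close>, the mean of the \<open>q\<close>-th powers is dominated by the quadratic mean, for
  which the parallelogram identity separates the midpoint from the difference.
\<close>

lemma bifractional_gap:
  fixes s t q K :: real
  assumes "0 \<le> s" "s \<le> t" "0 < q" "q \<le> 2" "0 < K" "K \<le> 1"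
  shows "2 * ((t powr q + s powr q) / 2) powr K
           \<le> t powr (q * K) + s powr (q * K) + (t - s) powr (q * K)"
proof (cases "q * K \<le> 1")
  case True
  have "((t powr q + s powr q) / 2) powr K \<le> (t powr q) powr K"
    using assms powr_mono2[of q s t] by (intro powr_mono2) auto
  also have "\<dots> = t powr (q * K)" by (simp add: powr_powr)
  finally have 1: "((t powr q + s powr q) / 2) powr K \<le> t powr (q * K)" .
  have "t powr (q * K) \<le> s powr (q * K) + (t - s) powr (q * K)"
    using powr_add_le_sum[of s "t - s" "q * K"] assms True by simp
  with 1 show ?thesis by linarith
next
  case False
  have "((t powr q + s powr q) / 2) powr K
      = (((t powr q + s powr q) / 2) powr (2 / q)) powr (q * K / 2)"
    using assms by (simp add: powr_powr)
  also have "\<dots> \<le> (((t powr q) powr (2 / q) + (s powr q) powr (2 / q)) / 2) powr (q * K / 2)"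
    using assms by (intro powr_mono2 powr_midpoint_le) auto
  also have "((t powr q) powr (2 / q) + (s powr q) powr (2 / q)) / 2
      = ((t + s) / 2)\<^sup>2 + ((t - s) / 2)\<^sup>2"
    using assms by (simp add: powr_powr field_simps power2_eq_square)
  also have "\<dots> powr (q * K / 2)
      \<le> (((t + s) / 2)\<^sup>2) powr (q * K / 2) + (((t - s) / 2)\<^sup>2) powr (q * K / 2)"
    using assms mult_mono[of q 2 K 1] by (intro powr_add_le_sum) auto
  also have "\<dots> = ((t + s) / 2) powr (q * K) + ((t - s) / 2) powr (q * K)"
  proof -
    have "(z\<^sup>2) powr (q * K / 2) = z powr (q * K)" if "0 \<le> z" for z :: real
      using that powr_powr[of z 2 "q * K / 2"] by simp
    then show ?thesis using assms by simp
  qed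
  \<comment> \<open>Convexity, as \<open>1 \<le> q * K\<close>; the second midpoint is taken between \<open>t - s\<close> and \<open>0\<close>.\<close>
  also have "\<dots> \<le> (t powr (q * K) + s powr (q * K)) / 2 + (t - s) powr (q * K) / 2"
    using powr_midpoint_le[of t s "q * K"] powr_midpoint_le[of "t - s" 0 "q * K"] assms False
    by (simp add: add_divide_distrib)
  finally have "2 * ((t powr q + s powr q) / 2) powr K
      \<le> 2 * ((t powr (q * K) + s powr (q * K)) / 2 + (t - s) powr (q * K) / 2)"
    by (rule mult_left_mono) simp
  then show ?thesis by (simp add: add_divide_distrib)
qed

section \<open>Perturbation of the exponent\<close>

text \<open>
  The power \<open>u powr \<kappa>\<close> absorbs the logarithmic singularity at \<open>0\<close>.  On \<open>[1, 4]\<close> the two factors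
  are at most \<open>16\<close> and \<open>3\<close>.
\<close>

lemma powr_ln_abs_le:
  fixes u c \<kappa> :: real
  assumes "0 < u" "u \<le> 4" "0 < \<kappa>" "\<kappa> \<le> c" "c \<le> 2"
  shows "u powr c * \<bar>ln u\<bar> \<le> 48 + 1 / \<kappa>"
proof (cases "u \<le> 1")
  case True
  have "ln (1 / u) \<le> (1 / u) powr \<kappa> / \<kappa>"
    using True assms by (intro ln_powr_bound) (auto simp: field_simps)
  then have "\<bar>ln u\<bar> \<le> u powr (-\<kappa>) / \<kappa>"
    using True assms by (simp add: ln_div powr_divide powr_minus_divide abs_if)
  then have "u powr c * \<bar>ln u\<bar> \<le> u powr c * (u powr (-\<kappa>) / \<kappa>)"
    by (intro mult_left_mono) auto
  also have "\<dots> = u powr (c - \<kappa>) / \<kappa>"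
    by (simp add: powr_add[symmetric])
  also have "\<dots> \<le> 1 / \<kappa>"
    using True assms powr_mono2[of "c - \<kappa>" u 1] by (simp add: divide_right_mono)
  finally show ?thesis by simp
next
  case False
  have "u powr c \<le> 4 powr 2"
    using False assms by (intro powr_mono_both) auto
  moreover have "ln u \<le> 3" using ln_le_minus_one[of u] assms by linarith
  ultimately have "u powr c * \<bar>ln u\<bar> \<le> 16 * 3"
    using False by (intro mult_mono) auto
  also have "\<dots> \<le> 48 + 1 / \<kappa>" using assms by simp
  finally show ?thesis .
qed

text \<open>
  The derivative of \<open>u powr p * ln u\<close> is at most a multiple of \<open>u powr (r - 1)\<close>, so the increments are
  dominated by those of \<open>u powr r / r\<close>, which is Hoelder continuous with exponent \<open>r \<le> 1\<close>.  The
  margin \<open>\<kappa>\<close> keeps the constant uniform in \<open>p\<close>.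
\<close>

lemma powr_ln_hoelder:
  fixes s t r p \<kappa> :: real
  assumes "0 \<le> s" "s \<le> t" "t \<le> 4" "0 < r" "r \<le> 1" "p \<le> 2" "0 < \<kappa>" "r + \<kappa> \<le> p"
  shows "\<bar>t powr p * ln t - s powr p * ln s\<bar> \<le> (112 + 2 / \<kappa>) / r * (t - s) powr r"
proof (cases "s = 0")
  case True
  show ?thesis
  proof (cases "t = 0")
    case False
    with assms True have t: "0 < t" by auto
    have "t powr p * \<bar>ln t\<bar> = t powr r * (t powr (p - r) * \<bar>ln t\<bar>)"
      by (simp add: powr_add[symmetric] mult.assoc[symmetric])
    also have "\<dots> \<le> t powr r * (48 + 1 / \<kappa>)"
      using assms t by (intro mult_left_mono powr_ln_abs_le) auto
    also have "\<dots> \<le> t powr r * ((112 + 2 / \<kappa>) / r)"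
    proof (intro mult_left_mono)
      have "48 + 1 / \<kappa> \<le> (112 + 2 / \<kappa>) / 1"
        using assms by (simp add: field_simps)
      also have "\<dots> \<le> (112 + 2 / \<kappa>) / r"
        using assms by (intro divide_left_mono) auto
      finally show "48 + 1 / \<kappa> \<le> (112 + 2 / \<kappa>) / r" .
    qed auto
    finally show ?thesis using True by (simp add: abs_mult mult.commute)
  qed (use True in auto)
next
  case False
  with assms have s: "0 < s" by simp
  define C where "C = 112 + 2 / \<kappa>"
  define g where "g u = u powr p * ln u" for u :: real
  define g' where "g' u = u powr (p - 1) * (p * ln u + 1)" for u :: real
  have dg: "(g has_real_derivative g' u) (at u)" if "0 < u" for u
    unfolding g_def g'_def using that
    by (auto intro!: derivative_eq_intros simp: powr_diff field_simps)
  have g'_bound: "\<bar>g' u\<bar> \<le> C * u powr (r - 1)" if "0 < u" "u \<le> 4" for u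
  proof -
    have "u powr (p - r) \<le> 4 powr (p - r)"
      using that assms by (intro powr_mono2) auto
    also have "\<dots> \<le> 4 powr 2" using assms by (intro powr_mono) auto
    finally have 1: "u powr (p - r) \<le> 16" by simp
    have 2: "u powr (p - r) * \<bar>ln u\<bar> \<le> 48 + 1 / \<kappa>"
      using that assms by (intro powr_ln_abs_le) auto
    have "\<bar>p * ln u + 1\<bar> \<le> 2 * \<bar>ln u\<bar> + 1"
      using assms mult_right_mono[of p 2 "\<bar>ln u\<bar>"] abs_triangle_ineq[of "p * ln u" 1]
      by (simp add: abs_mult)
    then have "u powr (p - r) * \<bar>p * ln u + 1\<bar> \<le> u powr (p - r) * (2 * \<bar>ln u\<bar> + 1)"
      by (intro mult_left_mono) auto
    also have "\<dots> \<le> C" using 1 2 by (simp add: C_def algebra_simps)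
    finally have "u powr (r - 1) * (u powr (p - r) * \<bar>p * ln u + 1\<bar>) \<le> u powr (r - 1) * C"
      by (intro mult_left_mono) auto
    then show ?thesis
      by (simp add: g'_def abs_mult mult.assoc[symmetric] powr_add[symmetric] mult.commute)
  qed
  have mono: "C / r * s powr r + c * g s \<le> C / r * t powr r + c * g t"
    if c: "c = 1 \<or> c = -1" for c
  proof (rule DERIV_nonneg_imp_nondecreasing[OF assms(2)])
    fix u assume "s \<le> u" "u \<le> t"
    with s assms have u: "0 < u" "u \<le> 4" by auto
    have "((\<lambda>u. C / r * u powr r + c * g u) has_real_derivative
             (C * u powr (r - 1) + c * g' u)) (at u)"
      using u assms by (auto intro!: derivative_eq_intros dg)
    moreover have "0 \<le> C * u powr (r - 1) + c * g' u"
      using g'_bound[OF u] c by auto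
    ultimately show "\<exists>y. ((\<lambda>u. C / r * u powr r + c * g u) has_real_derivative y) (at u) \<and> 0 \<le> y"
      by blast
  qed
  have C0: "0 \<le> C" using assms by (simp add: C_def)
  have "\<bar>g t - g s\<bar> \<le> C / r * (t powr r - s powr r)"
    using mono[of 1] mono[of "-1"] by (simp add: right_diff_distrib abs_le_iff)
  also have "\<dots> \<le> C / r * (t - s) powr r"
    using powr_add_le_sum[of s "t - s" r] assms C0 by (intro mult_left_mono) auto
  finally show ?thesis by (simp add: g_def C_def)
qed

lemma small_powr:
  fixes C e \<gamma> :: real
  assumes "0 \<le> C" "0 < e" "0 < \<gamma>"
  shows "\<exists>d>0. \<forall>h. 0 < h \<longrightarrow> h < d \<longrightarrow> C * h powr \<gamma> \<le> e"
proof (intro exI conjI allI impI)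
  show "0 < (e / (C + 1)) powr (1 / \<gamma>)" using assms by simp
next
  fix h :: real assume h: "0 < h" "h < (e / (C + 1)) powr (1 / \<gamma>)"
  have "h powr \<gamma> \<le> ((e / (C + 1)) powr (1 / \<gamma>)) powr \<gamma>"
    using h assms by (intro powr_mono2) auto
  also have "\<dots> = e / (C + 1)" using assms by (simp add: powr_powr)
  finally have "C * h powr \<gamma> \<le> C * (e / (C + 1))"
    using assms by (intro mult_left_mono)
  also have "\<dots> \<le> e" using assms by (simp add: field_simps)
  finally show "C * h powr \<gamma> \<le> e" .
qed

text \<open>
  This is \<open>exp y \<ge> 1 + y\<close> for \<open>y = x * ln u\<close>; both sides vanish at \<open>u = 0\<close>, as \<open>0 powr a = 0\<close>.
\<close>

lemma powr_perturb_first_order: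
  fixes u p x :: real
  assumes "0 \<le> u"
  shows "x * (u powr p * ln u) \<le> u powr (p + x) - u powr p"
proof (cases "u = 0")
  case False
  with assms have "u powr (p + x) - u powr p = u powr p * (exp (x * ln u) - 1)"
    by (simp add: powr_add powr_def[of u x] algebra_simps)
  moreover have "u powr p * (x * ln u) \<le> u powr p * (exp (x * ln u) - 1)"
    using exp_ge_add_one_self[of "x * ln u"]
    by (intro mult_left_mono powr_ge_zero) linarith
  ultimately show ?thesis by (simp add: mult_ac)
qed simp

lemma powr_perturb_second_order:
  fixes u p x :: real
  assumes "1 \<le> u" "0 \<le> x"
  shows "u powr p * (x * ln u + (x * ln u)\<^sup>2 / 2) \<le> u powr (p + x) - u powr p"
proof -
  have "u powr (p + x) - u powr p = u powr p * (exp (x * ln u) - 1)"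
    using assms by (simp add: powr_add powr_def[of u x] algebra_simps)
  moreover have "u powr p * (x * ln u + (x * ln u)\<^sup>2 / 2) \<le> u powr p * (exp (x * ln u) - 1)"
    using exp_lower_Taylor_quadratic[of "x * ln u"] assms by (intro mult_left_mono) auto
  ultimately show ?thesis by simp
qed

text \<open>
  For \<open>s \<ge> exp 1\<close> the logarithm is at least \<open>1\<close> and changes by a bounded factor over \<open>[s, s + 1]\<close>,
  so the mean value theorem gives the size of the increment in terms of \<open>s\<close> and \<open>t - s\<close>.  In the
  constant, \<open>4\<close> bounds the growth of \<open>u powr p\<close> on \<open>[s, 2 * s]\<close> and \<open>5\<close> comes from
  \<open>p * ln z + 1 \<le> 5 * ln s\<close>.
\<close>

lemma powr_ln_increment:
  fixes s t p :: real
  assumes "exp 1 \<le> s" "s < t" "t \<le> s + 1" "0 \<le> p" "p \<le> 2"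
  shows "0 \<le> t powr p * ln t - s powr p * ln s"
    and "t powr p * ln t - s powr p * ln s \<le> s powr p * (20 * ln s * ((t - s) / s))"
proof -
  have s2: "2 \<le> s" using assms(1) exp_ge_add_one_self[of 1] by linarith
  have ln_s: "1 \<le> ln s" using assms(1) s2 by (simp add: ln_ge_iff)
  have "\<exists>z. s < z \<and> z < t \<and> t powr p * ln t - s powr p * ln s
          = (t - s) * (z powr (p - 1) * (p * ln z + 1))"
    using assms s2
    by (intro MVT2) (auto intro!: derivative_eq_intros simp: powr_diff field_simps)
  then obtain z where z: "s < z" "z < t"
    and mvt: "t powr p * ln t - s powr p * ln s = (t - s) * (z powr (p - 1) * (p * ln z + 1))"
    by blast
  have ln_z: "ln s \<le> ln z" "ln z \<le> 2 * ln s"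
  proof -
    show "ln s \<le> ln z" using z s2 by simp
    have "ln z \<le> ln (s ^ 2)"
    proof -
      have "2 * s \<le> s\<^sup>2" using s2 by (simp add: power2_eq_square)
      then have "z \<le> s\<^sup>2" using z assms s2 by linarith
      then show ?thesis using z s2 by simp
    qed
    then show "ln z \<le> 2 * ln s" using s2 by (simp add: ln_realpow)
  qed
  show "0 \<le> t powr p * ln t - s powr p * ln s"
    unfolding mvt using assms z ln_z ln_s by (intro mult_nonneg_nonneg add_nonneg_nonneg) auto
  have "z powr p \<le> (2 * s) powr p"
    using z assms s2 by (intro powr_mono2) auto
  also have "\<dots> \<le> 4 * s powr p"
    using assms s2 powr_mono[of p 2 2] by (auto simp: powr_mult intro!: mult_right_mono)
  finally have zp: "z powr p \<le> 4 * s powr p" .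
  have "z powr (p - 1) = z powr p / z" using z s2 by (simp add: powr_diff)
  also have "\<dots> \<le> 4 * s powr p / s"
    using zp z s2 by (intro frac_le) auto
  finally have 1: "z powr (p - 1) \<le> 4 * s powr p / s" .
  have 2: "p * ln z + 1 \<le> 5 * ln s"
    using mult_mono[of p 2 "ln z" "2 * ln s"] assms ln_z ln_s by linarith
  have "(t - s) * (z powr (p - 1) * (p * ln z + 1)) \<le> (t - s) * ((4 * s powr p / s) * (5 * ln s))"
    using 1 2 assms s2 ln_z ln_s by (intro mult_left_mono mult_mono) auto
  then show "t powr p * ln t - s powr p * ln s \<le> s powr p * (20 * ln s * ((t - s) / s))"
    unfolding mvt by (simp add: mult_ac right_diff_distrib left_diff_distrib)
qed

text \<open>
  For \<open>x \<ge> 0\<close> the first-order term is nonnegative, as \<open>u powr p * ln u\<close> increases.  For \<open>x < 0\<close>, write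
  \<open>X = \<bar>x\<bar> * ln s\<close> and \<open>Y = (t - s) / s\<close>: the first-order term is at least \<open>- (20 * X * Y * s powr p)\<close>, and
  the exponent at \<open>s\<close> grows, so the quadratic term of the exponential contributes
  \<open>X\<^sup>2 / 2 * s powr p\<close>.  Completing the square leaves \<open>- (200 * Y\<^sup>2 * s powr p)\<close>, and \<open>p \<le> 2\<close> bounds this
  uniformly in \<open>s\<close>.
\<close>

lemma exponent_perturbation_large:
  fixes s t p x :: real
  assumes s: "exp 1 \<le> s" and st: "s < t" "t \<le> s + 1" and p: "0 \<le> p" "p \<le> 2"
  shows "t powr p + s powr p - 200 * (t - s)\<^sup>2 \<le> t powr (p + x) + s powr (p - x)"
proof -
  have s2: "2 \<le> s" using s exp_ge_add_one_self[of 1] by linarith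
  define \<Delta> where "\<Delta> = t powr p * ln t - s powr p * ln s"
  show ?thesis
  proof (cases "0 \<le> x")
    case True
    have "x * (t powr p * ln t) \<le> t powr (p + x) - t powr p"
      using s2 st by (intro powr_perturb_first_order) auto
    moreover have "- x * (s powr p * ln s) \<le> s powr (p - x) - s powr p"
      using s2 st powr_perturb_first_order[of s "-x" p] by simp
    moreover have "0 \<le> x * \<Delta>"
      using True powr_ln_increment(1)[OF s st p] by (simp add: \<Delta>_def)
    moreover have "0 \<le> 200 * (t - s)\<^sup>2" by simp
    ultimately show ?thesis unfolding \<Delta>_def right_diff_distrib by linarith
  next
    case False
    define y where "y = - x"
    have y: "0 \<le> y" using False by (simp add: y_def)
    define X where "X = y * ln s"
    define Y where "Y = (t - s) / s"
    have "- y * (t powr p * ln t) \<le> t powr (p + x) - t powr p"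
      using s2 st powr_perturb_first_order[of t x p] by (simp add: y_def)
    moreover have "s powr p * (X + X\<^sup>2 / 2) \<le> s powr (p - x) - s powr p"
      using s2 y powr_perturb_second_order[of s y p] by (simp add: y_def X_def)
    moreover have "y * \<Delta> \<le> s powr p * (20 * X * Y)"
      using mult_left_mono[OF powr_ln_increment(2)[OF s st p] y]
      by (simp add: \<Delta>_def X_def Y_def mult_ac)
    moreover have "s powr p * (20 * X * Y - X\<^sup>2 / 2) \<le> s powr p * (200 * Y\<^sup>2)"
    proof (intro mult_left_mono)
      have "0 \<le> (X - 20 * Y)\<^sup>2" by simp
      then show "20 * X * Y - X\<^sup>2 / 2 \<le> 200 * Y\<^sup>2"
        by (simp add: power2_eq_square algebra_simps)
    qed auto
    moreover have "s powr p * (200 * Y\<^sup>2) \<le> 200 * (t - s)\<^sup>2"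
    proof -
      have "s powr p \<le> s powr 2" using s2 p by (intro powr_mono) auto
      then have "s powr p \<le> s\<^sup>2" using s2 by simp
      then have "s powr p * (200 * Y\<^sup>2) \<le> s\<^sup>2 * (200 * Y\<^sup>2)"
        by (intro mult_right_mono) auto
      also have "\<dots> = 200 * (t - s)\<^sup>2"
        using s2 by (simp add: Y_def power_divide)
      finally show ?thesis .
    qed
    moreover have "s powr p * X = y * (s powr p * ln s)" by (simp add: X_def)
    moreover have "y * \<Delta> = y * (t powr p * ln t) - y * (s powr p * ln s)"
      by (simp add: \<Delta>_def right_diff_distrib)
    ultimately show ?thesis
      unfolding distrib_left right_diff_distrib mult_minus_left by linarith
  qed
qed

lemma exponent_perturbation_bounded:
  fixes s t p x r \<kappa> :: real
  assumes "0 \<le> s" "s \<le> t" "t \<le> 4" "0 < r" "r \<le> 1" "p \<le> 2" "0 < \<kappa>" "r + \<kappa> \<le> p"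
  shows "t powr p + s powr p - \<bar>x\<bar> * ((112 + 2 / \<kappa>) / r * (t - s) powr r)
           \<le> t powr (p + x) + s powr (p - x)"
proof -
  have "\<bar>x * (t powr p * ln t - s powr p * ln s)\<bar> \<le> \<bar>x\<bar> * ((112 + 2 / \<kappa>) / r * (t - s) powr r)"
    unfolding abs_mult by (intro mult_left_mono powr_ln_hoelder assms abs_ge_zero)
  moreover have "x * (t powr p * ln t) \<le> t powr (p + x) - t powr p"
    using assms by (intro powr_perturb_first_order) auto
  moreover have "- x * (s powr p * ln s) \<le> s powr (p - x) - s powr p"
    using assms powr_perturb_first_order[of s "-x" p] by simp
  ultimately show ?thesis by (simp add: right_diff_distrib abs_le_iff)
qed

text \<open>
  The two regimes are split at \<open>s = exp 1\<close>.  For large \<open>s\<close> the loss \<open>200 * (t - s)\<^sup>2\<close> is small against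
  \<open>(t - s) powr p\<close> because \<open>p \<le> p1 < 2\<close>.  For bounded \<open>s\<close> the loss has order \<open>(t - s) powr (\<beta> + r)\<close>
  with \<open>r\<close> just below \<open>min 1 p\<close>, and \<open>\<beta> + r > p\<close>: if \<open>r = 1\<close> this is the hypothesis
  \<open>p1 < 1 + \<beta>\<close>, otherwise \<open>r = p - \<kappa>\<close> with \<open>\<kappa> < \<beta>\<close>.
\<close>

lemma exponent_perturbation:
  fixes p0 p1 \<beta> C e :: real
  assumes "0 < p0" "p1 < 2" "p1 < 1 + \<beta>" "0 < \<beta>" "0 \<le> C" "0 < e"
  shows "\<exists>\<delta>>0. \<forall>s t p x. 0 \<le> s \<longrightarrow> s < t \<longrightarrow> t - s < \<delta> \<longrightarrow> p0 \<le> p \<longrightarrow> p \<le> p1 \<longrightarrow>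
           \<bar>x\<bar> \<le> C * (t - s) powr \<beta> \<longrightarrow>
           t powr p + s powr p - e * (t - s) powr p \<le> t powr (p + x) + s powr (p - x)"
proof -
  define \<kappa> where "\<kappa> = min (\<beta> / 2) (p0 / 2)"
  have \<kappa>: "0 < \<kappa>" "\<kappa> \<le> \<beta> / 2" "\<kappa> \<le> p0 / 2" using assms by (auto simp: \<kappa>_def)
  \<comment> \<open>A lower bound for the exponent \<open>r\<close> chosen below, uniform in \<open>p\<close>.\<close>
  define r0 where "r0 = min 1 (p0 / 2)"
  have r0: "0 < r0" using assms by (simp add: r0_def)
  define C' where "C' = C * ((112 + 2 / \<kappa>) / r0)"
  have C': "0 \<le> C'" using assms \<kappa> r0 by (simp add: C'_def)
  define \<gamma> where "\<gamma> = min (\<beta> / 2) (1 + \<beta> - p1)"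
  have \<gamma>: "0 < \<gamma>" using assms by (simp add: \<gamma>_def)
  obtain d1 where d1: "d1 > 0" "\<And>h. 0 < h \<Longrightarrow> h < d1 \<Longrightarrow> C' * h powr \<gamma> \<le> e"
    using small_powr[OF C' assms(6) \<gamma>] by blast
  obtain d2 where d2: "d2 > 0" "\<And>h. 0 < h \<Longrightarrow> h < d2 \<Longrightarrow> 200 * h powr (2 - p1) \<le> e"
    using small_powr[of 200 e "2 - p1"] assms by auto
  show ?thesis
  proof (intro exI conjI allI impI)
    show "0 < min 1 (min d1 d2)" using d1 d2 by simp
  next
    fix s t p x :: real
    assume s: "0 \<le> s" and st: "s < t" and d: "t - s < min 1 (min d1 d2)"
      and p: "p0 \<le> p" "p \<le> p1" and x: "\<bar>x\<bar> \<le> C * (t - s) powr \<beta>"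
    define h where "h = t - s"
    have h: "0 < h" "h < 1" "h < d1" "h < d2" using st d by (auto simp: h_def)
    show "t powr p + s powr p - e * (t - s) powr p \<le> t powr (p + x) + s powr (p - x)"
    proof (cases "exp 1 \<le> s")
      case True
      have "200 * h\<^sup>2 = 200 * h powr (2 - p) * h powr p"
        using h by (simp add: powr_add[symmetric])
      also have "\<dots> \<le> (200 * h powr (2 - p1)) * h powr p"
        using h p by (intro mult_right_mono mult_left_mono powr_mono') auto
      also have "\<dots> \<le> e * h powr p"
        using d2 h by (intro mult_right_mono) auto
      finally show ?thesis
        using exponent_perturbation_large[of s t p x] True st d p assms by (simp add: h_def)
    next
      case False
      then have t4: "t \<le> 4" using exp_le h by (simp add: h_def)
      define r where "r = min 1 (p - \<kappa>)"
      have r: "r0 \<le> r" "0 < r" "r \<le> 1" "r + \<kappa> \<le> p"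
        using p \<kappa> assms by (auto simp: r_def r0_def)
      have "\<bar>x\<bar> * ((112 + 2 / \<kappa>) / r * h powr r)
          \<le> (C * h powr \<beta>) * ((112 + 2 / \<kappa>) / r0 * h powr r)"
        using x r r0 \<kappa> assms
        by (intro mult_mono divide_left_mono mult_right_mono) (auto simp: h_def)
      also have "\<dots> = C' * h powr (\<beta> + r - p) * h powr p"
        by (simp add: C'_def powr_add[symmetric])
      also have "\<dots> \<le> C' * h powr \<gamma> * h powr p"
        using h C' p \<kappa>
        by (intro mult_right_mono mult_left_mono powr_mono') (auto simp: \<gamma>_def r_def)
      also have "\<dots> \<le> e * h powr p"
        using d1 h by (intro mult_right_mono) auto
      finally show ?thesis
        using exponent_perturbation_bounded[of s t r p \<kappa> x] s st t4 r p \<kappa> assms by (simp add: h_def)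
    qed
  qed
qed

section \<open>Lower bound for the increments\<close>

lemma mbbm_cov_diag:
  assumes "0 < H t" "H t < 1" "0 \<le> t"
  shows "mbbm_cov H K t t = t powr (2 * H t * K)"
proof -
  have "mbbm_cov H K t t = (1 / 2) powr K * (2 * t powr (2 * H t)) powr K"
    using assms by (simp add: mbbm_cov_def mbm_D_diag)
  also have "\<dots> = (1 / 2 * (2 * t powr (2 * H t))) powr K"
    by (rule powr_mult[symmetric])
  also have "\<dots> = t powr (2 * H t * K)" by (simp add: powr_powr)
  finally show ?thesis .
qed

text \<open>
  The coefficient of the loss at a constant exponent.  It has to be \<open>0\<close> for \<open>K = 1\<close>, where
  the gain coefficient \<open>2 powr (1 - K)\<close> is only \<open>1\<close> but the loss disappears by linearity.
\<close>

definition gap_coeff :: "real \<Rightarrow> real" where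
  "gap_coeff K = (if K = 1 then 0 else 1)"

lemma bifractional_gap_scaled:
  fixes s t q K d :: real
  assumes "0 \<le> s" "s \<le> t" "0 < q" "q \<le> 2" "0 < K" "K \<le> 1" and d: "0 \<le> d" "d \<le> 1 / 2"
  shows "2 * d powr K * (t powr q + s powr q) powr K
           \<le> t powr (q * K) + s powr (q * K) + gap_coeff K * (t - s) powr (q * K)"
proof -
  have "d powr K * (t powr q + s powr q) powr K \<le> (1 / 2) powr K * (t powr q + s powr q) powr K"
    using assms by (intro mult_right_mono powr_mono2) auto
  also have "\<dots> = (1 / 2 * (t powr q + s powr q)) powr K"
    by (rule powr_mult[symmetric])
  finally have "2 * d powr K * (t powr q + s powr q) powr K \<le> 2 * ((t powr q + s powr q) / 2) powr K"
    by simp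
  also have "\<dots> \<le> t powr (q * K) + s powr (q * K) + gap_coeff K * (t - s) powr (q * K)"
    using bifractional_gap[OF assms(1-6)] assms by (cases "K = 1") (auto simp: gap_coeff_def)
  finally show ?thesis .
qed

lemma gap_coeff_less:
  assumes "0 < K" "K \<le> 1"
  shows "gap_coeff K < 2 * (1 / 2) powr K"
proof (cases "K = 1")
  case False
  then have "(1 / 2) powr 1 < (1 / 2 :: real) powr K"
    using assms by (intro powr_less_mono') auto
  then show ?thesis using False by (simp add: gap_coeff_def)
qed (simp add: gap_coeff_def)

text \<open>
  For \<open>x \<le> C * h powr \<beta>\<close> the product \<open>x * ln (1 / h)\<close> stays below \<open>C / \<beta>\<close>, because
  \<open>ln (1 / h) \<le> h powr (- \<beta>) / \<beta>\<close>.
\<close>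

lemma powr_small_exponent_ge:
  fixes h \<beta> C x :: real
  assumes "0 < h" "h < 1" "0 < \<beta>" "0 \<le> x" "x \<le> C * h powr \<beta>"
  shows "exp (- (C / \<beta>)) \<le> h powr x"
proof -
  have "ln (1 / h) \<le> (1 / h) powr \<beta> / \<beta>"
    using assms by (intro ln_powr_bound) auto
  then have "- ln h \<le> h powr (- \<beta>) / \<beta>"
    using assms by (simp add: ln_div powr_divide powr_minus_divide)
  then have "x * (- ln h) \<le> (C * h powr \<beta>) * (h powr (- \<beta>) / \<beta>)"
    using assms by (intro mult_mono) (auto simp: ln_le_zero_iff)
  also have "\<dots> = C / \<beta>" using assms by (simp add: powr_minus field_simps)
  finally show ?thesis using assms by (simp add: powr_def)
qed

text \<open>
  The margin \<open>g\<close> between the gain \<open>2 * (1 / 2) powr K\<close> and the loss \<open>gap_coeff K\<close> is divided: one quarter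
  pays for \<open>D powr K\<close> falling short of its value on the diagonal, one quarter for the different
  exponents at \<open>s\<close> and \<open>t\<close>, and one half remains.  The bound on the supremum of \<open>H\<close> enters through
  \<open>p \<le> 2 * (SUP t\<in>{0..}. H t) < 1 + \<beta>\<close>.
\<close>

lemma mbbm_increment_variance_ge:
  fixes H :: "real \<Rightarrow> real" and K \<mu> \<nu> \<beta> :: real
  assumes K: "0 < K" "K \<le> 1" and "0 < \<mu>" "\<nu> < 1" "H \<in> {0..} \<rightarrow> {\<mu>..\<nu>}"
    and "0 < \<beta>" "holder_on {0..} \<beta> H" "(SUP t\<in>{0..}. H t) < \<beta>"
  shows "\<exists>\<delta>>0. \<exists>c>0. \<forall>s t. 0 \<le> s \<longrightarrow> s < t \<longrightarrow> t - s < \<delta> \<longrightarrow>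
           c * (t - s) powr (2 * min (H t) (H s) * K)
             \<le> mbbm_cov H K t t + mbbm_cov H K s s - 2 * mbbm_cov H K t s"
proof -
  obtain C where C: "0 \<le> C" and
    hoelder: "\<And>s t. 0 \<le> s \<Longrightarrow> 0 \<le> t \<Longrightarrow> \<bar>H t - H s\<bar> \<le> C * \<bar>t - s\<bar> powr \<beta>"
    using assms(7) unfolding holder_on_def by auto
  have H: "\<mu> \<le> H t" "H t \<le> \<nu>" "0 < H t" "H t < 1" if "0 \<le> t" for t
    using assms(3-5) that by (force simp: Pi_iff)+
  define \<nu>' where "\<nu>' = (SUP t\<in>{0..}. H t)"
  have H_sup: "H t \<le> \<nu>'" if "0 \<le> t" for t
    unfolding \<nu>'_def using that H(2) by (intro cSUP_upper bdd_aboveI2[of _ _ \<nu>]) auto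
  have "\<nu>' \<le> \<nu>" unfolding \<nu>'_def using H(2) by (intro cSUP_least) auto
  then have \<nu>': "0 < \<nu>'" "\<nu>' < 1" "\<nu>' < \<beta>"
    using H_sup[of 0] H[of 0] assms by (auto simp: \<nu>'_def)
  define g where "g = 2 * (1 / 2) powr K - gap_coeff K"
  have g: "0 < g" using gap_coeff_less[OF K] by (simp add: g_def)
  obtain \<eta> where \<eta>: "\<eta> > 0" and
    near: "\<And>x y. x \<in> {\<mu>..\<nu>} \<Longrightarrow> y \<in> {\<mu>..\<nu>} \<Longrightarrow> \<bar>x - y\<bar> < \<eta> \<Longrightarrow> (1 / 2) powr K - g / 8 \<le> mbm_D x y powr K"
    using mbm_D_powr_near_diag[of \<mu> \<nu> K "g / 8"] assms g by auto
  obtain d1 where d1: "d1 > 0" "\<And>h. 0 < h \<Longrightarrow> h < d1 \<Longrightarrow> C * h powr \<beta> \<le> \<eta> / 2"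
    using small_powr[OF C, of "\<eta> / 2" \<beta>] \<eta> assms by auto
  obtain d2 where d2: "d2 > 0" and perturb: "\<And>s t p x. 0 \<le> s \<Longrightarrow> s < t \<Longrightarrow> t - s < d2 \<Longrightarrow>
      2 * \<mu> * K \<le> p \<Longrightarrow> p \<le> 2 * \<nu>' \<Longrightarrow> \<bar>x\<bar> \<le> C * (t - s) powr \<beta> \<Longrightarrow>
      t powr p + s powr p - g / 4 * (t - s) powr p \<le> t powr (p + x) + s powr (p - x)"
    using exponent_perturbation[of "2 * \<mu> * K" "2 * \<nu>'" \<beta> C "g / 4"] assms \<nu>' C g K
    by auto
  have main: "g / 2 * exp (- (C / \<beta>)) * (t - s) powr (2 * min (H t) (H s) * K)
      \<le> mbbm_cov H K t t + mbbm_cov H K s s - 2 * mbbm_cov H K t s"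
    if s: "0 \<le> s" and st: "s < t" and d: "t - s < min 1 (min d1 d2)" for s t
  proof -
    have t: "0 \<le> t" using s st by simp
    define h where "h = t - s"
    have h: "0 < h" "h < 1" "h < d1" "h < d2" using st d by (auto simp: h_def)
    define q p x where "q = H t + H s" and "p = (H t + H s) * K" and "x = (H t - H s) * K"
    define D where "D = mbm_D (H t) (H s)"
    have diff: "\<bar>H t - H s\<bar> \<le> C * h powr \<beta>" using hoelder[OF s t] st by (simp add: h_def)
    have x: "\<bar>x\<bar> \<le> C * h powr \<beta>"
      using diff K mult_mono[of "\<bar>H t - H s\<bar>" "\<bar>H t - H s\<bar>" K 1] by (simp add: x_def abs_mult)
    have "\<bar>H t - H s\<bar> < \<eta>" using diff d1(2)[of h] h \<eta> by simp
    then have D_near: "(1 / 2) powr K - g / 8 \<le> D powr K"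
      unfolding D_def using H[OF s] H[OF t] by (intro near) auto
    have D: "0 \<le> D" "D \<le> 1 / 2"
      unfolding D_def using H[OF s] H[OF t] mbm_D_nonneg mbm_D_le_half by blast+
    have p: "2 * \<mu> * K \<le> p" "p \<le> 2 * \<nu>'"
    proof -
      have "(2 * \<mu>) * K \<le> (H t + H s) * K" using K H(1)[OF s] H(1)[OF t] by (intro mult_right_mono) auto
      then show "2 * \<mu> * K \<le> p" by (simp add: p_def)
      have "(H t + H s) * K \<le> (2 * \<nu>') * 1"
        using K H_sup[OF s] H_sup[OF t] H(3)[OF s] H(3)[OF t] by (intro mult_mono) auto
      then show "p \<le> 2 * \<nu>'" by (simp add: p_def)
    qed
    have "mbbm_cov H K t t + mbbm_cov H K s s - 2 * mbbm_cov H K t s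
        = t powr (p + x) + s powr (p - x)
          - 2 * D powr K * (t powr q + s powr q) powr K + 2 * D powr K * h powr p"
      using st s t H[OF s] H[OF t] mbbm_cov_diag[of H t K] mbbm_cov_diag[of H s K]
      by (simp add: mbbm_cov_def D_def q_def p_def x_def h_def algebra_simps)
    moreover have "t powr p + s powr p - g / 4 * h powr p \<le> t powr (p + x) + s powr (p - x)"
      unfolding h_def using x h by (intro perturb s st p) (auto simp: h_def)
    moreover have "2 * D powr K * (t powr q + s powr q) powr K
        \<le> t powr p + s powr p + gap_coeff K * h powr p"
      using bifractional_gap_scaled[of s t q K D] s st K D H[OF s] H[OF t]
      by (simp add: q_def p_def h_def)
    moreover have "(gap_coeff K + 3 / 4 * g) * h powr p \<le> 2 * D powr K * h powr p"
    proof (intro mult_right_mono)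
      show "gap_coeff K + 3 / 4 * g \<le> 2 * D powr K" using D_near g_def by linarith
    qed auto
    ultimately have 1: "g / 2 * h powr p
        \<le> mbbm_cov H K t t + mbbm_cov H K s s - 2 * mbbm_cov H K t s"
      by (simp add: distrib_right)
    \<comment> \<open>Trading the exponent \<open>p\<close> for the smaller \<open>2 * min (H t) (H s) * K\<close>.\<close>
    have "p = \<bar>x\<bar> + 2 * min (H t) (H s) * K"
      using K by (auto simp: p_def x_def abs_mult min_def abs_if algebra_simps)
    then have "h powr p = h powr \<bar>x\<bar> * h powr (2 * min (H t) (H s) * K)"
      by (simp add: powr_add)
    moreover have "exp (- (C / \<beta>)) * h powr (2 * min (H t) (H s) * K)
        \<le> h powr \<bar>x\<bar> * h powr (2 * min (H t) (H s) * K)"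
      using powr_small_exponent_ge[of h \<beta> "\<bar>x\<bar>" C] h x assms(6) by (intro mult_right_mono) auto
    ultimately have "g / 2 * (exp (- (C / \<beta>)) * h powr (2 * min (H t) (H s) * K)) \<le> g / 2 * h powr p"
      using g by (intro mult_left_mono) auto
    with 1 show ?thesis by (simp add: h_def mult.assoc)
  qed
  have "0 < min 1 (min d1 d2)" "0 < g / 2 * exp (- (C / \<beta>))" using d1 d2 g by simp_all
  with main show ?thesis by blast
qed

theorem theorem2:
  fixes M :: "'a measure" and B :: "real \<Rightarrow> 'a \<Rightarrow> real"
    and H :: "real \<Rightarrow> real" and K \<mu> \<nu> \<beta> :: real
  assumes "0 < K" and "K \<le> 1"
    and "0 < \<mu>" and "\<nu> < 1" and "H \<in> {0..} \<rightarrow> {\<mu>..\<nu>}"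
    and "0 < \<beta>" and "holder_on {0..} \<beta> H"
    and "(SUP t\<in>{0..}. H t) < \<beta>"
    and "mbbm M H K B"
  shows "\<exists>\<delta>>0. \<forall>m::nat. m \<ge> 1 \<longrightarrow> (\<exists>M\<^sub>m>0. \<forall>s\<ge>0. \<forall>t\<ge>0. \<bar>t - s\<bar> < \<delta> \<longrightarrow>
    (\<integral>\<omega>. \<bar>B t \<omega> - B s \<omega>\<bar> ^ m \<partial>M) \<ge> M\<^sub>m * \<bar>t - s\<bar> powr (real m * min (H t) (H s) * K))"
proof -
  obtain \<delta> c where "\<delta> > 0" "c > 0" and
    var: "\<And>s t. 0 \<le> s \<Longrightarrow> s < t \<Longrightarrow> t - s < \<delta> \<Longrightarrow>
      c * (t - s) powr (2 * min (H t) (H s) * K)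
        \<le> mbbm_cov H K t t + mbbm_cov H K s s - 2 * mbbm_cov H K t s"
    using mbbm_increment_variance_ge[OF assms(1-8)] by blast
  have ps: "prob_space M" using assms(9) by (simp add: mbbm_def gaussian_process_def)
  have "\<exists>M\<^sub>m>0. \<forall>s\<ge>0. \<forall>t\<ge>0. \<bar>t - s\<bar> < \<delta> \<longrightarrow>
      (\<integral>\<omega>. \<bar>B t \<omega> - B s \<omega>\<bar> ^ m \<partial>M) \<ge> M\<^sub>m * \<bar>t - s\<bar> powr (real m * min (H t) (H s) * K)"
    if m: "m \<ge> 1" for m :: nat
  proof -
    obtain k where k: "k > 0" and moment: "\<And>X. gaussian_rv M X \<Longrightarrow> (\<integral>\<omega>. X \<omega> \<partial>M) = 0 \<Longrightarrow>
        (\<integral>\<omega>. \<bar>X \<omega>\<bar> ^ m \<partial>M) = k * sqrt (\<integral>\<omega>. (X \<omega>)\<^sup>2 \<partial>M) ^ m"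
      using gaussian_rv_abs_moment[OF ps, of m] m by auto
    have ordered: "k * sqrt c ^ m * (t - s) powr (real m * min (H t) (H s) * K)
        \<le> (\<integral>\<omega>. \<bar>B t \<omega> - B s \<omega>\<bar> ^ m \<partial>M)" if st: "0 \<le> s" "s < t" "t - s < \<delta>" for s t
    proof -
      define a where "a = min (H t) (H s) * K"
      have "sqrt c * (t - s) powr a = sqrt (c * (t - s) powr (2 * a))"
        using \<open>c > 0\<close> st powr_powr[of "t - s" a 2]
        by (simp add: real_sqrt_mult powr_half_sqrt[symmetric] powr_powr)
      also have "\<dots> \<le> sqrt (\<integral>\<omega>. (B t \<omega> - B s \<omega>)\<^sup>2 \<partial>M)"
        using var[OF st] mbbm_increment(3)[OF assms(9), of s t] st
        by (intro real_sqrt_le_mono) (simp add: a_def mult.assoc)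
      finally have "(sqrt c * (t - s) powr a) ^ m \<le> sqrt (\<integral>\<omega>. (B t \<omega> - B s \<omega>)\<^sup>2 \<partial>M) ^ m"
        using \<open>c > 0\<close> by (intro power_mono) auto
      moreover have "(sqrt c * (t - s) powr a) ^ m = sqrt c ^ m * (t - s) powr (real m * a)"
        using st by (simp add: power_mult_distrib powr_powr powr_realpow[symmetric] mult.commute)
      ultimately have "k * (sqrt c ^ m * (t - s) powr (real m * a))
          \<le> k * sqrt (\<integral>\<omega>. (B t \<omega> - B s \<omega>)\<^sup>2 \<partial>M) ^ m"
        using k by (intro mult_left_mono) auto
      also have "\<dots> = (\<integral>\<omega>. \<bar>B t \<omega> - B s \<omega>\<bar> ^ m \<partial>M)"
        using st by (intro moment[symmetric] mbbm_increment[OF assms(9)]) auto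
      finally show ?thesis by (simp add: a_def mult.assoc)
    qed
    have "k * sqrt c ^ m * \<bar>t - s\<bar> powr (real m * min (H t) (H s) * K)
        \<le> (\<integral>\<omega>. \<bar>B t \<omega> - B s \<omega>\<bar> ^ m \<partial>M)" if st: "0 \<le> s" "0 \<le> t" "\<bar>t - s\<bar> < \<delta>" for s t
    proof (cases s t rule: linorder_cases)
      case less
      then show ?thesis using ordered[of s t] st by simp
    next
      case equal
      \<comment> \<open>The lower bound vanishes, since \<open>0 powr a = 0\<close> for every \<open>a\<close>.\<close>
      then show ?thesis by (simp add: integral_nonneg_AE)
    next
      case greater
      then show ?thesis
        using ordered[of t s] st by (simp add: abs_minus_commute min.commute)
    qed
    then show ?thesis using k \<open>c > 0\<close> by (intro exI[of _ "k * sqrt c ^ m"]) auto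
  qed
  with \<open>\<delta> > 0\<close> show ?thesis by blast
qed

end
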